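(* Let $(X,d)$ be a compact metric space with a computable structure $\mathcal I$, and let $T:X\to X$ be such that $(X,T)$ is a constructive dynamical system. Let $f:\mathbf N\to\mathbf R$ be monotone with $f(n)\to\infty$, and let $\mu$ be a Borel measure on $X$. Then for $\mu$-almost every $x\in X$ $$K^f(x)\ \ge\ \underline d_\mu(x)\, R^f(x)$$ (the inequality being asserted whenever the product on the right is not the indeterminate form $0\cdot\infty$).
   Context: All logarithms are in base 2. All indicators below take values in $[-\infty,+\infty]$, with $-\log 0=+\infty$. **Strings and algorithmic information content.** $\Sigma=\{0,1\}^*$ is the set of finite (possibly empty) binary strings, $|s|$ is the length of $s$. Let $c:\Sigma\to\mathbf N$ be the bijection $\emptyset\mapsto0,\ 0\mapsto1,\ 1\mapsto2,\ 00\mapsto3,\ 01\mapsto4,\dots$ (length-lexicographic order). For $s=s_0\dots s_{n-1}$ put $\hat s=s_0s_0s_1s_1\dots s_{n-1}s_{n-1}01$. Let $A_1,A_2,\dots$ be a recursive enumeration of all Turing machines (partial recursive functions $\Sigma\to\Sigma$). A machine $\mathcal U$ is universal if $\mathcal U(\widehat{c^{-1}(m)}\,p)=A_m(p)$ for all $m,p$. A universal machine $\mathcal U$ is fixed once and for all, and $AIC(s)=\min\{|p|:\mathcal U(p)=s\}$. For words over a finite alphabet $\{0,\dots,N-1\}$, $AIC$ is defined in the same way through a fixed computable bijective encoding of such words as elements of $\Sigma$. **Computable structures.** A computable interpretation on a metric space $(X,d)$ is a map $I:\Sigma\to X$ with dense image for which there is a total recursive $D:\Sigma\times\Sigma\times\mathbf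 N\to\mathbf Q$ with $|d(I(s_1),I(s_2))-D(s_1,s_2,n)|\le2^{-n}$ for all $s_1,s_2,n$. Two computable interpretations $I_1,I_2$ are equivalent if there is a total recursive $D^*:\Sigma\times\Sigma\times\mathbf N\to\mathbf Q$ with $|d(I_1(s_1),I_2(s_2))-D^*(s_1,s_2,n)|\le2^{-n}$ for all $s_1,s_2,n$. A computable structure $\mathcal I$ on $X$ is an equivalence class of computable interpretations. **Constructive systems.** $T:X\to X$ is constructive if (i) it is a morphism: $T$ is uniformly continuous and for all $I,J\in\mathcal I$ there is a total recursive $D^*:\Sigma\times\Sigma\times\mathbf N\to\mathbf Q$ with $|d(T(I(s_1)),J(s_2))-D^*(s_1,s_2,n)|\le2^{-n}$ for all $s_1,s_2,n$; and (ii) it is effectively uniformly continuous: there is a total recursive $g:\mathbf N\to\mathbf N$ such that $d(x,y)<2^{-g(n)}$ implies $d(T(x),T(y))<2^{-n}$ for all $x,y,n$. Then $(X,T)$ is called a constructive dynamical system. **Orbit complexity.** For a finite open cover $\beta=\{B_0,\dots,B_{N-1}\}$ of $X$ let $\varphi_\beta(x)=\{\omega\in\{0,\dots,N-1\}^{\mathbf N}:T^n(x)\in B_{\omega(n)}\ \forall n\in\mathbf N\}$, and let $\omega^n$ be the word of the first $n$ digits of $\omega$. Put $$K^f(x,T,\beta)=\limsup_{n\to\infty}\ \min_{\omega\in\varphi_\beta(x)}\frac{AIC(\omega^n)}{f(n)},\qquad K^f(x)=K^f(x,T)=\sup_\beta K^f(x,T,\beta),$$ the supremum being over all finite open covers $\beta$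 of $X$. **Minimum initial-condition sensitivity.** $B(n,x,\epsilon)=\{y\in X: d(T^i(y),T^i(x))\le\epsilon\ \text{for all}\ 0\le i\le n\}$; $B_R(x)$ is the open ball of center $x$ and radius $R$; $R(x,n,\epsilon)=\inf\{R: B_R(x)\supset B(n,x,\epsilon)\}$; $R^f_\epsilon(x)=\limsup_{n\to\infty}\frac{-\log R(x,n,\epsilon)}{f(n)}$; $R^f(x)=\sup_{\epsilon>0}R^f_\epsilon(x)$. **Local dimension of a measure.** $\underline d_\mu(x)=\liminf_{\epsilon\to0}\frac{\log\mu(B(x,\epsilon))}{\log\epsilon}$, where $B(x,\epsilon)$ is the open ball of center $x$ and radius $\epsilon$. *)

theory Defs
  imports "HOL-Analysis.Analysis" "HOL-Library.Nat_Bijection"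
begin

section \<open>Partial recursive functions\<close>

text \<open>
  Partial recursive functions on the natural numbers, as unary functions: several arguments are
  packed with the Cantor pairing \<^const>\<open>prod_encode\<close>. The rule \<open>prec\<close> is primitive
  recursion with a parameter \<open>a\<close>, the rule \<open>mu\<close> is unbounded minimisation.
\<close>

definition minimise :: "(nat \<Rightarrow> nat option) \<Rightarrow> nat option" where
  "minimise h =
     (if \<exists>n. h n = Some 0 \<and> (\<forall>m<n. \<exists>y. h m = Some y \<and> y \<noteq> 0)
      then Some (LEAST n. h n = Some 0) else None)"

inductive nat_partial_recursive :: "(nat \<Rightarrow> nat option) \<Rightarrow> bool" where
  zero: "nat_partial_recursive (\<lambda>n. Some 0)"
| succ: "nat_partial_recursive (\<lambda>n. Some (Suc n))"
| left: "nat_partial_recursive (\<lambda>n. Some (fst (prod_decode n)))"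
| right: "nat_partial_recursive (\<lambda>n. Some (snd (prod_decode n)))"
| pair: "nat_partial_recursive g \<Longrightarrow> nat_partial_recursive h \<Longrightarrow>
    nat_partial_recursive
      (\<lambda>n. Option.bind (g n) (\<lambda>a. Option.bind (h n) (\<lambda>b. Some (prod_encode (a, b)))))"
| comp: "nat_partial_recursive g \<Longrightarrow> nat_partial_recursive h \<Longrightarrow>
    nat_partial_recursive (\<lambda>n. Option.bind (h n) g)"
| prec: "nat_partial_recursive g \<Longrightarrow> nat_partial_recursive h \<Longrightarrow>
    nat_partial_recursive
      (\<lambda>n. case prod_decode n of (a, k) \<Rightarrow>
        rec_nat (g a) (\<lambda>i r. Option.bind r (\<lambda>v. h (prod_encode (a, prod_encode (i, v))))) k)"
| mu: "nat_partial_recursive g \<Longrightarrow>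
    nat_partial_recursive (\<lambda>a. minimise (\<lambda>n. g (prod_encode (a, n))))"

definition total_recursive :: "(nat \<Rightarrow> nat) \<Rightarrow> bool" where
  "total_recursive h \<longleftrightarrow> nat_partial_recursive (\<lambda>n. Some (h n))"


section \<open>Strings, machines and algorithmic information content\<close>

type_synonym str = "bool list"

text \<open>
  The digits 0 and 1 are \<^const>\<open>False\<close> and \<^const>\<open>True\<close>. The length-lexicographic
  numbering is bijective base-2 numeration, the digits 0 and 1 having the weights 1 and 2.
\<close>

definition str_code :: "str \<Rightarrow> nat" where
  "str_code s = foldl (\<lambda>m b. 2 * m + (if b then 2 else 1)) 0 s"

lemma str_code_Nil [simp]: "str_code [] = 0"
  by (simp add: str_code_def)

lemma str_code_snoc [simp]: "str_code (s @ [b]) = 2 * str_code s + (if b then 2 else 1)"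
  by (simp add: str_code_def)

lemma str_code_examples:
  "str_code [False] = 1" "str_code [True] = 2"
  "str_code [False, False] = 3" "str_code [False, True] = 4"
  "str_code [True, False] = 5" "str_code [True, True] = 6"
  by (simp_all add: str_code_def)

lemma inj_str_code: "inj str_code"
proof (rule injI)
  fix s t :: str
  show "str_code s = str_code t \<Longrightarrow> s = t"
  proof (induction s arbitrary: t rule: rev_induct)
    case Nil
    then show ?case by (cases t rule: rev_cases) (auto split: if_splits)
  next
    case (snoc b s)
    show ?case
    proof (cases t rule: rev_cases)
      case Nil
      with snoc.prems show ?thesis by (auto split: if_splits)
    next
      case (snoc t' b')
      with snoc.prems have e: "2 * str_code s + (if b then 2 else 1)
          = 2 * str_code t' + (if b' then 2 else (1::nat))" by simp
      have "b = b'"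
        using e by (cases b; cases b'; simp; presburger)
      moreover from this e have "str_code s = str_code t'" by simp
      ultimately show ?thesis using snoc.IH \<open>t = t' @ [b']\<close> by blast
    qed
  qed
qed

lemma surj_str_code: "surj str_code"
proof -
  have "\<exists>s. str_code s = n" for n
  proof (induction n rule: less_induct)
    case (less n)
    show ?case
    proof (cases "n = 0")
      case True
      then show ?thesis using str_code_Nil by blast
    next
      case False
      then have "(n - 1) div 2 < n" by linarith
      then obtain s where s: "str_code s = (n - 1) div 2" using less by blast
      have "str_code (s @ [even n]) = n"
        using False s by (cases "even n") (auto elim!: evenE oddE)
      then show ?thesis by blast
    qed
  qed
  then show ?thesis by (metis surjI)
qed

lemma bij_str_code: "bij str_code"
  by (simp add: bij_def inj_str_code surj_str_code)

definition str_of :: "nat \<Rightarrow> str" where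
  "str_of = inv str_code"

lemma str_of_str_code [simp]: "str_of (str_code s) = s"
  by (simp add: str_of_def inj_str_code)

lemma str_code_str_of [simp]: "str_code (str_of n) = n"
  by (simp add: str_of_def surj_str_code surj_f_inv_f)

definition hat :: "str \<Rightarrow> str" where
  "hat s = concat (map (\<lambda>b. [b, b]) s) @ [False, True]"

text \<open>Partial functions on strings; \<^const>\<open>None\<close> stands for divergence.\<close>

definition partial_recursive :: "(str \<Rightarrow> str option) \<Rightarrow> bool" where
  "partial_recursive F \<longleftrightarrow>
     nat_partial_recursive (\<lambda>n. map_option str_code (F (str_of n)))"

text \<open>
  The enumeration is \<open>A 1, A 2, \<dots>\<close>; the value \<open>A 0\<close> is irrelevant. It is recursive in the sense
  that \<open>A m p\<close> is partial recursive jointly in \<open>m\<close> and \<open>p\<close>.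
\<close>

definition recursive_enumeration :: "(nat \<Rightarrow> str \<Rightarrow> str option) \<Rightarrow> bool" where
  "recursive_enumeration A \<longleftrightarrow>
     A ` {1..} = {F. partial_recursive F} \<and>
     nat_partial_recursive
       (\<lambda>n. case prod_decode n of (m, k) \<Rightarrow> map_option str_code (A (Suc m) (str_of k)))"

definition universal_machine ::
    "(nat \<Rightarrow> str \<Rightarrow> str option) \<Rightarrow> (str \<Rightarrow> str option) \<Rightarrow> bool" where
  "universal_machine A U \<longleftrightarrow>
     partial_recursive U \<and> (\<forall>m\<ge>1. \<forall>p. U (hat (str_of m) @ p) = A m p)"

definition AIC :: "(str \<Rightarrow> str option) \<Rightarrow> str \<Rightarrow> nat" where
  "AIC U s = (LEAST l. \<exists>p. U p = Some s \<and> length p = l)"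

text \<open>
  \<open>enc N\<close> encodes the words over the alphabet \<open>{0, \<dots>, N - 1}\<close> as strings. Computability of a
  function on words refers to the standard numbering \<^const>\<open>list_encode\<close> of lists.
\<close>

definition computable_word_encoding :: "(nat \<Rightarrow> nat list \<Rightarrow> str) \<Rightarrow> bool" where
  "computable_word_encoding enc \<longleftrightarrow>
     (\<forall>N\<ge>1. bij_betw (enc N) {w. set w \<subseteq> {..<N}} UNIV \<and>
        (\<exists>h. total_recursive h \<and>
           (\<forall>w. set w \<subseteq> {..<N} \<longrightarrow> str_code (enc N w) = h (list_encode w))))"


section \<open>Computable structures and constructive systems\<close>

text \<open>A rational-valued function is given by recursive numerator and denominator.\<close>

definition recursive_rat :: "(str \<Rightarrow> str \<Rightarrow> nat \<Rightarrow> rat) \<Rightarrow> bool" where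
  "recursive_rat D \<longleftrightarrow>
     (\<exists>a b q. total_recursive a \<and> total_recursive b \<and> total_recursive q \<and>
        (\<forall>s1 s2 n. let z = prod_encode (str_code s1, prod_encode (str_code s2, n)) in
           D s1 s2 n = (of_nat (a z) - of_nat (b z)) / of_nat (Suc (q z))))"

definition computable_dist :: "(str \<Rightarrow> 'a::metric_space) \<Rightarrow> (str \<Rightarrow> 'a) \<Rightarrow> bool" where
  "computable_dist u v \<longleftrightarrow>
     (\<exists>D. recursive_rat D \<and>
        (\<forall>s1 s2 n. \<bar>dist (u s1) (v s2) - real_of_rat (D s1 s2 n)\<bar> \<le> 1 / 2 ^ n))"

definition computable_interpretation :: "(str \<Rightarrow> 'a::metric_space) \<Rightarrow> bool" where
  "computable_interpretation I \<longleftrightarrow> closure (range I) = UNIV \<and> computable_dist I I"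

definition interpretation_rel :: "((str \<Rightarrow> 'a::metric_space) \<times> (str \<Rightarrow> 'a)) set" where
  "interpretation_rel =
     {(I, J). computable_interpretation I \<and> computable_interpretation J \<and> computable_dist I J}"

definition computable_structure :: "(str \<Rightarrow> 'a::metric_space) set \<Rightarrow> bool" where
  "computable_structure \<I> \<longleftrightarrow> \<I> \<in> {I. computable_interpretation I} // interpretation_rel"

definition morphism :: "(str \<Rightarrow> 'a::metric_space) set \<Rightarrow> ('a \<Rightarrow> 'a) \<Rightarrow> bool" where
  "morphism \<I> T \<longleftrightarrow>
     uniformly_continuous_on UNIV T \<and> (\<forall>I\<in>\<I>. \<forall>J\<in>\<I>. computable_dist (T \<circ> I) J)"

definition effectively_uniformly_continuous :: "('a::metric_space \<Rightarrow> 'a) \<Rightarrow> bool" where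
  "effectively_uniformly_continuous T \<longleftrightarrow>
     (\<exists>g. total_recursive g \<and>
        (\<forall>x y n. dist x y < 1 / 2 ^ g n \<longrightarrow> dist (T x) (T y) < 1 / 2 ^ n))"

definition constructive :: "(str \<Rightarrow> 'a::metric_space) set \<Rightarrow> ('a \<Rightarrow> 'a) \<Rightarrow> bool" where
  "constructive \<I> T \<longleftrightarrow> morphism \<I> T \<and> effectively_uniformly_continuous T"


section \<open>Orbit complexity\<close>

text \<open>A finite open cover \<open>{B 0, \<dots>, B (N - 1)}\<close> is given as the list of its members.\<close>

definition finite_open_cover :: "'a::topological_space set list \<Rightarrow> bool" where
  "finite_open_cover \<beta> \<longleftrightarrow> (\<forall>B\<in>set \<beta>. open B) \<and> \<Union>(set \<beta>) = UNIV"

definition symbolic_orbits ::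
    "('a \<Rightarrow> 'a) \<Rightarrow> 'a set list \<Rightarrow> 'a \<Rightarrow> (nat \<Rightarrow> nat) set" where
  "symbolic_orbits T \<beta> x = {\<omega>. \<forall>n. \<omega> n < length \<beta> \<and> (T ^^ n) x \<in> \<beta> ! \<omega> n}"

text \<open>The infimum below is a minimum: there are only finitely many words of length \<open>n\<close>.\<close>

definition orbit_complexity_cover ::
    "(str \<Rightarrow> str option) \<Rightarrow> (nat \<Rightarrow> nat list \<Rightarrow> str) \<Rightarrow> (nat \<Rightarrow> real) \<Rightarrow>
     ('a \<Rightarrow> 'a) \<Rightarrow> 'a set list \<Rightarrow> 'a \<Rightarrow> ereal" where
  "orbit_complexity_cover U enc f T \<beta> x =
     limsup (\<lambda>n. INF \<omega>\<in>symbolic_orbits T \<beta> x.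
       ereal (real (AIC U (enc (length \<beta>) (map \<omega> [0..<n])))) / ereal (f n))"

definition orbit_complexity ::
    "(str \<Rightarrow> str option) \<Rightarrow> (nat \<Rightarrow> nat list \<Rightarrow> str) \<Rightarrow> (nat \<Rightarrow> real) \<Rightarrow>
     ('a::metric_space \<Rightarrow> 'a) \<Rightarrow> 'a \<Rightarrow> ereal" where
  "orbit_complexity U enc f T x =
     (SUP \<beta>\<in>{\<beta>. finite_open_cover \<beta>}. orbit_complexity_cover U enc f T \<beta> x)"


section \<open>Initial-condition sensitivity and local dimension\<close>

definition log2_ext :: "ennreal \<Rightarrow> ereal" where
  "log2_ext r =
     (if r = 0 then -\<infinity> else if r = \<infinity> then \<infinity> else ereal (log 2 (enn2real r)))"

definition orbit_ball :: "('a::metric_space \<Rightarrow> 'a) \<Rightarrow> nat \<Rightarrow> 'a \<Rightarrow> real \<Rightarrow> 'a set" where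
  "orbit_ball T n x \<epsilon> = {y. \<forall>i\<le>n. dist ((T ^^ i) y) ((T ^^ i) x) \<le> \<epsilon>}"

definition orbit_radius :: "('a::metric_space \<Rightarrow> 'a) \<Rightarrow> 'a \<Rightarrow> nat \<Rightarrow> real \<Rightarrow> real" where
  "orbit_radius T x n \<epsilon> = Inf {R. orbit_ball T n x \<epsilon> \<subseteq> ball x R}"

definition sensitivity_at ::
    "(nat \<Rightarrow> real) \<Rightarrow> ('a::metric_space \<Rightarrow> 'a) \<Rightarrow> real \<Rightarrow> 'a \<Rightarrow> ereal" where
  "sensitivity_at f T \<epsilon> x =
     limsup (\<lambda>n. - log2_ext (ennreal (orbit_radius T x n \<epsilon>)) / ereal (f n))"

definition sensitivity :: "(nat \<Rightarrow> real) \<Rightarrow> ('a::metric_space \<Rightarrow> 'a) \<Rightarrow> 'a \<Rightarrow> ereal" where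
  "sensitivity f T x = (SUP \<epsilon>\<in>{0<..}. sensitivity_at f T \<epsilon> x)"

definition lower_local_dim :: "'a::metric_space measure \<Rightarrow> 'a \<Rightarrow> ereal" where
  "lower_local_dim \<mu> x =
     Liminf (at_right 0) (\<lambda>\<epsilon>. log2_ext (emeasure \<mu> (ball x \<epsilon>)) / ereal (log 2 \<epsilon>))"

text \<open>
  The product of \<^typ>\<open>ereal\<close> totalises \<open>0 \<sqdot> \<infinity>\<close> to \<open>0\<close>, so the indeterminate
  products have to be singled out explicitly.
\<close>

definition indeterminate_product :: "ereal \<Rightarrow> ereal \<Rightarrow> bool" where
  "indeterminate_product a b \<longleftrightarrow>
     (a = 0 \<and> \<bar>b\<bar> = \<infinity>) \<or> (\<bar>a\<bar> = \<infinity> \<and> b = 0)"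

end

theory Submission
  imports Defs
begin

text \<open>
  The inequality is a counting statement: there are only \<open>2 ^ l\<close> programs of length \<open>l\<close>, so the orbits
  with short descriptions can be located with too few small balls to carry any measure.

  Fix \<open>d\<close> below the local dimension, \<open>r\<close> below the sensitivity and \<open>\<kappa> < d r\<close>, and suppose that the
  orbit complexity of \<open>x\<close> is below \<open>\<kappa>\<close>. For a cover \<open>\<beta>\<close> of small mesh, the orbit of \<open>x\<close> up to a large
  time \<open>n\<close> is described by a program \<open>p\<close> with \<open>\<bar>p\<bar> \<le> \<kappa> f n\<close>, while for infinitely many \<open>n\<close> a
  description of the orbit up to time \<open>n\<close> fixes \<open>x\<close> up to an error \<open>\<delta> = 2 powr (- r f n)\<close>. Where balls
  of radius \<open>\<delta>\<close> have measure at most \<open>\<delta> powr d\<close>, a single program \<open>p\<close> therefore accounts for a set of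
  measure at most a constant times \<open>2 powr (- (d r / \<kappa>) \<bar>p\<bar>)\<close> (\<open>located_points_small\<close>). Since
  \<open>d r / \<kappa> > 1\<close>, these bounds are summable over all programs, and by the Borel--Cantelli lemma almost
  every point is accounted for by finitely many programs only (\<open>AE_in_finitely_many\<close>). But \<open>x\<close> uses a
  different program for each of infinitely many times \<open>n\<close>, since the program determines the length of
  the word that it prints. So almost no \<open>x\<close> is of this kind (\<open>AE_not_compressible\<close>).

  The sum runs over programs and not over times. That makes the argument insensitive to the growth
  of \<open>f\<close>: a sum over times would diverge for a slowly growing \<open>f\<close>. For the same reason, \<open>n\<close>
  digits are described and the digit at time \<open>n\<close> is supplied separately, at the cost of a constant
  factor, as \<open>f (n + 1)\<close> may be much larger than \<open>f n\<close>. The exceptional set is finally handled by letting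
  \<open>d\<close>, \<open>r\<close>, \<open>\<kappa>\<close> and the mesh range over countable sets. Computability enters through
  the fact that every string has a program (\<open>AIC_attained\<close>).
\<close>

section \<open>Counting programs\<close>

lemma str_code_less: "str_code s + 1 < 2 ^ (length s + 1)"
  by (induction s rule: rev_induct) auto

text \<open>
  Borel--Cantelli over the set of all programs. There are \<open>2 ^ l\<close> strings of length \<open>l\<close>, so the bounds
  sum to a geometric series of ratio \<open>2 powr (1 - c)\<close>; in the length-lexicographic numbering
  the bound for the \<open>n\<close>-th string is of the order of \<open>n powr (- c)\<close>.
\<close>

lemma AE_in_finitely_many:
  fixes E :: "str \<Rightarrow> 'a set"
  assumes cover: "\<And>p. \<exists>M\<in>sets \<mu>. E p \<subseteq> M \<and>
      emeasure \<mu> M \<le> ennreal (C * 2 powr (- c * real (length p)))"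
    and "c > 1" "C \<ge> 0"
  shows "AE x in \<mu>. finite {p. x \<in> E p}"
proof -
  obtain M where M: "\<And>p. M p \<in> sets \<mu>" "\<And>p. E p \<subseteq> M p"
      "\<And>p. emeasure \<mu> (M p) \<le> ennreal (C * 2 powr (- c * real (length p)))"
    using cover by metis
  define A where "A n = M (str_of n)" for n
  have bound: "measure \<mu> (A n) \<le> C * 2 powr c * real (Suc n) powr (- c)" for n
  proof -
    let ?l = "real (length (str_of n))"
    have "real (Suc n) \<le> real (2 ^ (length (str_of n) + 1))"
      using str_code_less[of "str_of n"] by (simp del: of_nat_power)
    also have "\<dots> = 2 powr (?l + 1)"
      by (simp add: powr_add powr_realpow)
    finally have "(2 powr (?l + 1)) powr (- c) \<le> real (Suc n) powr (- c)"
      using \<open>c > 1\<close> by (intro powr_mono2') auto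
    moreover have "2 powr (- c * ?l) = 2 powr c * (2 powr (?l + 1)) powr (- c)"
      by (simp add: powr_powr powr_add[symmetric] algebra_simps)
    ultimately have "2 powr (- c * ?l) \<le> 2 powr c * real (Suc n) powr (- c)"
      by simp
    then have "C * 2 powr (- c * ?l) \<le> C * 2 powr c * real (Suc n) powr (- c)"
      using \<open>C \<ge> 0\<close> by (metis mult.assoc mult_left_mono)
    moreover have "measure \<mu> (A n) \<le> C * 2 powr (- c * ?l)"
      using M(3)[of "str_of n"] \<open>C \<ge> 0\<close> unfolding A_def measure_def
      by (intro enn2real_leI) auto
    ultimately show ?thesis by simp
  qed
  have "summable (\<lambda>n. real n powr (- c))"
    using \<open>c > 1\<close> by (subst summable_real_powr_iff) simp
  then have "summable (\<lambda>n. real (Suc n) powr (- c))"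
    by (subst summable_Suc_iff)
  then have "summable (\<lambda>n. C * 2 powr c * real (Suc n) powr (- c))"
    by (rule summable_mult)
  then have sm: "summable (\<lambda>n. measure \<mu> (A n))"
    by (rule summable_comparison_test_ev[rotated]) (use bound in simp)
  have "AE x in \<mu>. eventually (\<lambda>n. x \<in> space \<mu> - A n) sequentially"
  proof (rule borel_cantelli_AE1[OF _ _ sm])
    show "A n \<in> sets \<mu>" for n
      by (simp add: A_def M)
    show "emeasure \<mu> (A n) < \<infinity>" for n
      using M(3)[of "str_of n"] unfolding A_def by (metis ennreal_less_top infinity_ennreal_def order_le_less_trans)
  qed
  then show ?thesis
  proof (eventually_elim)
    case (elim x)
    then obtain m where m: "\<And>n. n \<ge> m \<Longrightarrow> x \<notin> A n"
      unfolding eventually_sequentially by auto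
    have "{p. x \<in> E p} \<subseteq> str_of ` {..<m}"
    proof
      fix p assume "p \<in> {p. x \<in> E p}"
      then have "x \<in> A (str_code p)"
        using M(2)[of p] by (auto simp: A_def)
      then have "str_code p < m"
        using m not_less by blast
      then show "p \<in> str_of ` {..<m}"
        by (metis imageI lessThan_iff str_of_str_code)
    qed
    then show ?case
      by (rule finite_subset) simp
  qed
qed

text \<open>
  The complexity of a string is a minimum over a nonempty set, because the identity is among the
  machines that a universal machine simulates.
\<close>

lemma AIC_attained:
  assumes "recursive_enumeration A" "universal_machine A U"
  shows "\<exists>p. U p = Some s \<and> length p = AIC U s"
proof -
  have "nat_partial_recursive (\<lambda>n. Some n)"
    using nat_partial_recursive.pair[OF nat_partial_recursive.left nat_partial_recursive.right]
    by simp
  then have "partial_recursive (\<lambda>t. Some t)"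
    by (simp add: partial_recursive_def)
  then have "(\<lambda>t. Some t) \<in> A ` {1..}"
    using assms(1) by (simp add: recursive_enumeration_def)
  then obtain m where m: "m \<ge> 1" "A m = (\<lambda>t. Some t)"
    by auto
  then have "U (hat (str_of m) @ s) = Some s"
    using assms(2) by (simp add: universal_machine_def)
  then have "\<exists>l p. U p = Some s \<and> length p = l"
    by blast
  then show ?thesis
    unfolding AIC_def by (rule LeastI_ex)
qed

section \<open>Sensitivity and local dimension in terms of balls\<close>

lemma log2_ext_less_iff: "log2_ext a < ereal t \<longleftrightarrow> a < ennreal (2 powr t)"
proof (cases a)
  case (real c)
  show ?thesis
  proof (cases "c = 0")
    case True
    then show ?thesis using real by (simp add: log2_ext_def)
  next
    case False
    with real have "c > 0" by simp
    then have "log2_ext a = ereal (log 2 c)"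
      using real by (simp add: log2_ext_def)
    then show ?thesis
      using \<open>c > 0\<close> real by (simp add: log_less_iff ennreal_less_iff)
  qed
qed (simp add: log2_ext_def)

lemma limsup_gt_frequently:
  fixes u :: "nat \<Rightarrow> ereal"
  assumes "c < limsup u"
  shows "\<exists>\<^sub>F n in sequentially. c < u n"
proof (rule ccontr)
  assume "\<not> (\<exists>\<^sub>F n in sequentially. c < u n)"
  then have "\<forall>\<^sub>F n in sequentially. u n \<le> c"
    by (simp add: not_frequently not_less)
  then have "limsup u \<le> c"
    by (rule Limsup_bounded)
  with assms show False by simp
qed

lemma orbit_ball_subset_of_radius_less:
  fixes T :: "'a::metric_space \<Rightarrow> 'a"
  assumes "bounded (UNIV :: 'a set)" "orbit_radius T x n \<epsilon> < \<rho>"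
  shows "orbit_ball T n x \<epsilon> \<subseteq> ball x \<rho>"
proof -
  obtain C where "UNIV \<subseteq> ball x C"
    using assms(1) bounded_subset_ballD by blast
  then have "{R. orbit_ball T n x \<epsilon> \<subseteq> ball x R} \<noteq> {}"
    by blast
  then obtain R where "orbit_ball T n x \<epsilon> \<subseteq> ball x R" "R < \<rho>"
    using cInf_lessD[OF _ assms(2)[unfolded orbit_radius_def]] by auto
  then show ?thesis
    by (auto simp: subset_eq intro: less_trans)
qed

lemma frequently_orbit_ball_small:
  fixes T :: "'a::metric_space \<Rightarrow> 'a"
  assumes "bounded (UNIV :: 'a set)" "filterlim f at_top sequentially"
    and "ereal r < sensitivity_at f T \<epsilon> x" "\<eta> \<le> \<epsilon>"
  shows "\<exists>\<^sub>F n in sequentially. orbit_ball T n x \<eta> \<subseteq> ball x (2 powr (- r * f n))"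
proof -
  have ev: "\<forall>\<^sub>F n in sequentially. f n > 0"
    using assms(2) by (simp add: filterlim_at_top_dense)
  have "\<exists>\<^sub>F n in sequentially. ereal r < - log2_ext (ennreal (orbit_radius T x n \<epsilon>)) / ereal (f n)"
    using assms(3) unfolding sensitivity_at_def by (rule limsup_gt_frequently)
  then have "\<exists>\<^sub>F n in sequentially.
      ereal r < - log2_ext (ennreal (orbit_radius T x n \<epsilon>)) / ereal (f n) \<and> f n > 0"
    using ev by (rule frequently_eventually_frequently)
  then show ?thesis
  proof (rule frequently_elim1)
    fix n
    assume n: "ereal r < - log2_ext (ennreal (orbit_radius T x n \<epsilon>)) / ereal (f n) \<and> f n > 0"
    then have "ereal (f n) * ereal r < - log2_ext (ennreal (orbit_radius T x n \<epsilon>))"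
      using ereal_less_divide_pos[of "ereal (f n)" "ereal r"
          "- log2_ext (ennreal (orbit_radius T x n \<epsilon>))"] by simp
    then have "log2_ext (ennreal (orbit_radius T x n \<epsilon>)) < ereal (- r * f n)"
      by (cases "log2_ext (ennreal (orbit_radius T x n \<epsilon>))") (auto simp: mult.commute)
    then have "ennreal (orbit_radius T x n \<epsilon>) < ennreal (2 powr (- r * f n))"
      by (simp only: log2_ext_less_iff)
    then have "orbit_radius T x n \<epsilon> < 2 powr (- r * f n)"
      by (meson ennreal_leI not_less)
    then have "orbit_ball T n x \<epsilon> \<subseteq> ball x (2 powr (- r * f n))"
      by (rule orbit_ball_subset_of_radius_less[OF assms(1)])
    moreover have "orbit_ball T n x \<eta> \<subseteq> orbit_ball T n x \<epsilon>"
      using assms(4) by (auto simp: orbit_ball_def intro: order_trans)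
    ultimately show "orbit_ball T n x \<eta> \<subseteq> ball x (2 powr (- r * f n))"
      by blast
  qed
qed

text \<open>
  Boundedness of the space keeps \<open>- log R\<close> bounded below, and dividing by \<open>f n\<close> makes this
  lower bound vanish in the limit.
\<close>

lemma sensitivity_nonneg:
  fixes T :: "'a::metric_space \<Rightarrow> 'a"
  assumes "bounded (UNIV :: 'a set)" "filterlim f at_top sequentially"
  shows "0 \<le> sensitivity f T x"
proof -
  obtain C where "C > 0" and C: "UNIV \<subseteq> ball x C"
    using assms(1) bounded_subset_ballD by blast
  have le: "log2_ext (ennreal (orbit_radius T x n 1)) \<le> ereal (log 2 (2 * C))" for n
  proof -
    have "R > 0" if "orbit_ball T n x 1 \<subseteq> ball x R" for R
    proof -
      have "x \<in> orbit_ball T n x 1"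
        by (simp add: orbit_ball_def)
      with that have "x \<in> ball x R" by blast
      then show ?thesis by (metis centre_in_ball)
    qed
    then have "bdd_below {R. orbit_ball T n x 1 \<subseteq> ball x R}"
      by (intro bdd_belowI[of _ 0]) (auto simp: less_imp_le)
    then have "orbit_radius T x n 1 \<le> C"
      unfolding orbit_radius_def using C by (intro cInf_lower) auto
    then have "ennreal (orbit_radius T x n 1) < ennreal (2 powr (log 2 (2 * C)))"
      using \<open>C > 0\<close> by (intro ennreal_lessI) auto
    then show ?thesis
      unfolding log2_ext_less_iff[symmetric] by simp
  qed
  have ev: "\<forall>\<^sub>F n in sequentially. f n > 0"
    using assms(2) by (simp add: filterlim_at_top_dense)
  have "((\<lambda>n. - log 2 (2 * C) / f n) \<longlongrightarrow> 0) sequentially"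
    by (rule real_tendsto_divide_at_top[OF tendsto_const assms(2)])
  then have "limsup (\<lambda>n. ereal (- log 2 (2 * C) / f n)) = 0"
    by (intro lim_imp_Limsup) (auto simp: zero_ereal_def)
  moreover have "limsup (\<lambda>n. ereal (- log 2 (2 * C) / f n)) \<le> sensitivity_at f T 1 x"
    unfolding sensitivity_at_def
  proof (rule Limsup_mono, use ev in eventually_elim)
    case (elim n)
    have "- ereal (log 2 (2 * C)) \<le> - log2_ext (ennreal (orbit_radius T x n 1))"
      using le[of n] by (simp only: ereal_minus_le_minus)
    then have "- ereal (log 2 (2 * C)) / ereal (f n)
        \<le> - log2_ext (ennreal (orbit_radius T x n 1)) / ereal (f n)"
      using elim by (intro ereal_divide_right_mono) auto
    then show ?case
      using elim by simp
  qed
  moreover have "sensitivity_at f T 1 x \<le> sensitivity f T x"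
    unfolding sensitivity_def by (rule SUP_upper) simp
  ultimately show ?thesis
    by (metis order_trans)
qed

text \<open>
  The points at which the dimension bound already holds at all scales up to \<open>\<delta>\<close>. Their union over
  \<open>\<delta>\<close> contains every point of local dimension above \<open>d\<close>; fixing \<open>\<delta>\<close> makes the bound uniform,
  as it will be applied at centres over which there is no control.
\<close>

definition ball_decay_set :: "'a::metric_space measure \<Rightarrow> real \<Rightarrow> real \<Rightarrow> 'a set" where
  "ball_decay_set \<mu> d \<delta> =
     {x. \<forall>\<rho>. 0 < \<rho> \<and> \<rho> \<le> \<delta> \<longrightarrow> emeasure \<mu> (ball x \<rho>) \<le> ennreal (\<rho> powr d)}"

lemma lower_local_dim_gt_imp_ball_decay:
  assumes "ereal d < lower_local_dim \<mu> x"
  shows "\<exists>k. x \<in> ball_decay_set \<mu> d (1 / real (Suc k))"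
proof -
  have "\<forall>\<^sub>F \<rho> in at_right 0.
      ereal d < log2_ext (emeasure \<mu> (ball x \<rho>)) / ereal (log 2 \<rho>)"
    using assms unfolding lower_local_dim_def by (rule less_LiminfD)
  then obtain b where "b > 0" and b: "\<And>\<rho>. 0 < \<rho> \<Longrightarrow> \<rho> < b \<Longrightarrow>
      ereal d < log2_ext (emeasure \<mu> (ball x \<rho>)) / ereal (log 2 \<rho>)"
    unfolding eventually_at_right_field by auto
  obtain k where k: "1 / real (Suc k) < min b 1"
    using \<open>b > 0\<close> nat_approx_posE[of "min b 1"] by (metis less_numeral_extra(1) min_less_iff_conj)
  have "emeasure \<mu> (ball x \<rho>) \<le> ennreal (\<rho> powr d)" if "0 < \<rho>" "\<rho> \<le> 1 / real (Suc k)" for \<rho>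
  proof -
    have "\<rho> < b" "\<rho> < 1"
      using that k by linarith+
    then have neg: "log 2 \<rho> < 0"
      using that by simp
    have "ereal d < log2_ext (emeasure \<mu> (ball x \<rho>)) / ereal (log 2 \<rho>)"
      using b that \<open>\<rho> < b\<close> by blast
    \<comment> \<open>Multiplication by the negative number \<open>log 2 \<rho>\<close> reverses the inequality.\<close>
    then have "log2_ext (emeasure \<mu> (ball x \<rho>)) < ereal (d * log 2 \<rho>)"
      using neg by (cases "log2_ext (emeasure \<mu> (ball x \<rho>))") (auto simp: field_simps)
    then have "emeasure \<mu> (ball x \<rho>) < ennreal (2 powr (d * log 2 \<rho>))"
      by (simp only: log2_ext_less_iff)
    also have "2 powr (d * log 2 \<rho>) = (2 powr log 2 \<rho>) powr d"
      by (simp only: powr_powr mult.commute)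
    also have "\<dots> = \<rho> powr d"
      using that by simp
    finally show ?thesis by simp
  qed
  then show ?thesis
    unfolding ball_decay_set_def by blast
qed

section \<open>Points located by short programs\<close>

text \<open>
  The program \<open>p\<close> prints the first \<open>n\<close> digits of \<open>\<omega>\<close> and is short, while the orbit of \<open>x\<close> up to time
  \<open>n\<close>, known to precision \<open>\<eta>\<close>, pins \<open>x\<close> down to the small radius on the right.
\<close>

definition locates ::
    "(str \<Rightarrow> str option) \<Rightarrow> (nat \<Rightarrow> nat list \<Rightarrow> str) \<Rightarrow> (nat \<Rightarrow> real) \<Rightarrow>
     ('a::metric_space \<Rightarrow> 'a) \<Rightarrow> 'a set list \<Rightarrow> real \<Rightarrow> real \<Rightarrow> real \<Rightarrow> str \<Rightarrow> 'a \<Rightarrow>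
     (nat \<Rightarrow> nat) \<Rightarrow> nat \<Rightarrow> bool" where
  "locates U enc f T \<beta> \<eta> r \<kappa> p x \<omega> n \<longleftrightarrow>
     \<omega> \<in> symbolic_orbits T \<beta> x \<and>
     U p = Some (enc (length \<beta>) (map \<omega> [0..<n])) \<and>
     real (length p) \<le> \<kappa> * f n \<and>
     orbit_ball T n x \<eta> \<subseteq> ball x (2 powr (- r * f n))"

lemma locates_same_word:
  assumes "inj_on (enc (length \<beta>)) {w. set w \<subseteq> {..<length \<beta>}}"
    and "locates U enc f T \<beta> \<eta> r \<kappa> p x \<omega> n" "locates U enc f T \<beta> \<eta> r \<kappa> p y \<omega>' n'"
  shows "n = n'" "\<And>i. i < n \<Longrightarrow> \<omega> i = \<omega>' i"
proof -
  have "set (map \<omega> [0..<n]) \<subseteq> {..<length \<beta>}" "set (map \<omega>' [0..<n']) \<subseteq> {..<length \<beta>}"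
    using assms(2,3) by (auto simp: locates_def symbolic_orbits_def)
  moreover have "enc (length \<beta>) (map \<omega> [0..<n]) = enc (length \<beta>) (map \<omega>' [0..<n'])"
    using assms(2,3) by (simp add: locates_def)
  ultimately have eq: "map \<omega> [0..<n] = map \<omega>' [0..<n']"
    by (intro inj_onD[OF assms(1)]) auto
  then show "n = n'"
    by (metis length_map length_upt diff_zero)
  with eq show "\<And>i. i < n \<Longrightarrow> \<omega> i = \<omega>' i"
    by simp
qed

text \<open>
  Two points located by the same program whose next digits agree visit the same members of the cover
  up to time \<open>n\<close>. By the mesh condition each lies in the orbit ball of the other, so all of them lie in
  one ball around any one of them, whose measure decays as prescribed. The cover has \<open>length \<beta>\<close> digits,
  hence as many balls suffice.
\<close>

lemma located_points_small:
  fixes T :: "'a::metric_space \<Rightarrow> 'a"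
  assumes mesh: "\<And>B y z. B \<in> set \<beta> \<Longrightarrow> y \<in> B \<Longrightarrow> z \<in> B \<Longrightarrow> dist y z \<le> \<eta>"
    and inj: "inj_on (enc (length \<beta>)) {w. set w \<subseteq> {..<length \<beta>}}"
    and sets: "sets \<mu> = sets borel"
    and pos: "d > 0" "r > 0" "\<kappa> > 0"
  shows "\<exists>M\<in>sets \<mu>.
      {x \<in> ball_decay_set \<mu> d \<delta>.
        \<exists>\<omega> n. locates U enc f T \<beta> \<eta> r \<kappa> p x \<omega> n \<and> 2 powr (- r * f n) \<le> \<delta>} \<subseteq> M \<and>
      emeasure \<mu> M \<le> ennreal (real (length \<beta>) * 2 powr (- (d * r / \<kappa>) * real (length p)))"
proof -
  let ?m = "2 powr (- (d * r / \<kappa>) * real (length p))"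
  define L where "L x \<omega> n \<longleftrightarrow> x \<in> ball_decay_set \<mu> d \<delta> \<and>
      locates U enc f T \<beta> \<eta> r \<kappa> p x \<omega> n \<and> 2 powr (- r * f n) \<le> \<delta>" for x \<omega> n
  have "\<exists>M\<in>sets \<mu>. {x. \<exists>\<omega> n. L x \<omega> n \<and> \<omega> n = j} \<subseteq> M \<and> emeasure \<mu> M \<le> ennreal ?m" for j
  proof (cases "{x. \<exists>\<omega> n. L x \<omega> n \<and> \<omega> n = j} = {}")
    case True
    then show ?thesis
      by (intro bexI[of _ "{}"]) auto
  next
    case False
    then obtain x \<omega> n where x: "L x \<omega> n" "\<omega> n = j"
      by blast
    let ?\<rho> = "2 powr (- r * f n)"
    have "y \<in> ball x ?\<rho>" if y: "L y \<omega>' n'" "\<omega>' n' = j" for y \<omega>' n'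
    proof -
      have "locates U enc f T \<beta> \<eta> r \<kappa> p x \<omega> n" "locates U enc f T \<beta> \<eta> r \<kappa> p y \<omega>' n'"
        using x(1) y(1) by (simp_all add: L_def)
      note same = locates_same_word[where enc = enc and \<beta> = \<beta>, OF inj this]
      have "dist ((T ^^ i) y) ((T ^^ i) x) \<le> \<eta>" if "i \<le> n" for i
      proof -
        have "\<omega> i = \<omega>' i"
          using same x(2) y(2) that by (cases "i = n") auto
        moreover have "(T ^^ i) x \<in> \<beta> ! \<omega> i" "(T ^^ i) y \<in> \<beta> ! \<omega>' i" "\<omega> i < length \<beta>"
          using x(1) y(1) by (auto simp: L_def locates_def symbolic_orbits_def)
        ultimately show ?thesis
          by (intro mesh[of "\<beta> ! \<omega> i"]) simp_all
      qed
      then have "y \<in> orbit_ball T n x \<eta>"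
        by (simp add: orbit_ball_def)
      then show ?thesis
        using x(1) by (auto simp: L_def locates_def)
    qed
    then have "{x. \<exists>\<omega> n. L x \<omega> n \<and> \<omega> n = j} \<subseteq> ball x ?\<rho>"
      by blast
    moreover have "emeasure \<mu> (ball x ?\<rho>) \<le> ennreal ?m"
    proof -
      have "emeasure \<mu> (ball x ?\<rho>) \<le> ennreal (?\<rho> powr d)"
        using x(1) by (simp add: L_def ball_decay_set_def)
      also have "?\<rho> powr d \<le> ?m"
      proof -
        have "real (length p) / \<kappa> \<le> f n"
          using x(1) pos by (simp add: L_def locates_def field_simps)
        then have "(d * r) * (real (length p) / \<kappa>) \<le> (d * r) * f n"
          using pos by (intro mult_left_mono) auto
        then show ?thesis
          by (simp add: powr_powr algebra_simps)
      qed
      finally show ?thesis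
        by (simp add: ennreal_leI)
    qed
    moreover have "ball x ?\<rho> \<in> sets \<mu>"
      by (simp add: sets)
    ultimately show ?thesis
      by blast
  qed
  then have "\<forall>j. \<exists>M. M \<in> sets \<mu> \<and> {x. \<exists>\<omega> n. L x \<omega> n \<and> \<omega> n = j} \<subseteq> M \<and> emeasure \<mu> M \<le> ennreal ?m"
    by (simp only: Bex_def) blast
  from choice[OF this] obtain M where "\<forall>j. M j \<in> sets \<mu> \<and>
      {x. \<exists>\<omega> n. L x \<omega> n \<and> \<omega> n = j} \<subseteq> M j \<and> emeasure \<mu> (M j) \<le> ennreal ?m"
    ..
  then have M: "\<And>j. M j \<in> sets \<mu>" "\<And>j. {x. \<exists>\<omega> n. L x \<omega> n \<and> \<omega> n = j} \<subseteq> M j"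
      "\<And>j. emeasure \<mu> (M j) \<le> ennreal ?m"
    by (simp_all only: simp_thms)
  show ?thesis
  proof (intro bexI conjI)
    show "(\<Union>j<length \<beta>. M j) \<in> sets \<mu>"
      using M(1) by blast
    show "{x \<in> ball_decay_set \<mu> d \<delta>. \<exists>\<omega> n. locates U enc f T \<beta> \<eta> r \<kappa> p x \<omega> n \<and>
        2 powr (- r * f n) \<le> \<delta>} \<subseteq> (\<Union>j<length \<beta>. M j)"
    proof
      fix x
      assume "x \<in> {x \<in> ball_decay_set \<mu> d \<delta>. \<exists>\<omega> n. locates U enc f T \<beta> \<eta> r \<kappa> p x \<omega> n \<and>
        2 powr (- r * f n) \<le> \<delta>}"
      then obtain \<omega> n where L: "L x \<omega> n"
        by (auto simp: L_def)
      then have "\<omega> n < length \<beta>"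
        by (simp add: L_def locates_def symbolic_orbits_def)
      moreover have "x \<in> M (\<omega> n)"
        using L M(2) by blast
      ultimately show "x \<in> (\<Union>j<length \<beta>. M j)"
        by blast
    qed
    have "emeasure \<mu> (\<Union>j<length \<beta>. M j) \<le> (\<Sum>j<length \<beta>. emeasure \<mu> (M j))"
      using M(1) by (intro emeasure_subadditive_finite) auto
    also have "\<dots> \<le> (\<Sum>j<length \<beta>. ennreal ?m)"
      by (intro sum_mono M(3))
    also have "\<dots> = ennreal (real (length \<beta>) * ?m)"
      by (simp add: ennreal_mult ennreal_of_nat_eq_real_of_nat)
    finally show "emeasure \<mu> (\<Union>j<length \<beta>. M j) \<le> ennreal (real (length \<beta>) * ?m)" .
  qed
qed

lemma eventually_short_program:
  assumes "recursive_enumeration A" "universal_machine A U"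
    and "filterlim f at_top sequentially"
    and "orbit_complexity_cover U enc f T \<beta> x < ereal \<kappa>"
  shows "\<forall>\<^sub>F n in sequentially. \<exists>\<omega>\<in>symbolic_orbits T \<beta> x. \<exists>p.
      U p = Some (enc (length \<beta>) (map \<omega> [0..<n])) \<and> real (length p) \<le> \<kappa> * f n"
proof -
  have ev: "\<forall>\<^sub>F n in sequentially. f n > 0"
    using assms(3) by (simp add: filterlim_at_top_dense)
  have "\<forall>\<^sub>F n in sequentially. (INF \<omega>\<in>symbolic_orbits T \<beta> x.
      ereal (real (AIC U (enc (length \<beta>) (map \<omega> [0..<n])))) / ereal (f n)) < ereal \<kappa>"
    using assms(4) unfolding orbit_complexity_cover_def by (rule Limsup_lessD)
  then show ?thesis
    using ev
  proof eventually_elim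
    case (elim n)
    then obtain \<omega> where \<omega>: "\<omega> \<in> symbolic_orbits T \<beta> x"
        "ereal (real (AIC U (enc (length \<beta>) (map \<omega> [0..<n])))) / ereal (f n) < ereal \<kappa>"
      by (auto simp: INF_less_iff)
    then have "real (AIC U (enc (length \<beta>) (map \<omega> [0..<n]))) \<le> \<kappa> * f n"
      using elim(2) by (simp add: field_simps)
    then show ?case
      using \<omega>(1) AIC_attained[OF assms(1,2)] by metis
  qed
qed

text \<open>
  The core of the theorem, for fixed parameters: sensitivity above \<open>r\<close> yields infinitely many times \<open>n\<close>
  at which a short program locates \<open>x\<close>, and different times need different programs.
\<close>

lemma AE_not_compressible:
  fixes T :: "'a::metric_space \<Rightarrow> 'a"
  assumes enum: "recursive_enumeration A" and univ: "universal_machine A U"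
    and bdd: "bounded (UNIV :: 'a set)"
    and f: "filterlim f at_top sequentially"
    and sets: "sets \<mu> = sets borel"
    and mesh: "\<And>B y z. B \<in> set \<beta> \<Longrightarrow> y \<in> B \<Longrightarrow> z \<in> B \<Longrightarrow> dist y z \<le> \<eta>"
    and inj: "inj_on (enc (length \<beta>)) {w. set w \<subseteq> {..<length \<beta>}}"
    and pos: "d > 0" "r > 0" "\<kappa> > 0" and less: "\<kappa> < d * r"
  shows "AE x in \<mu>. \<forall>\<epsilon>\<ge>\<eta>. ereal d < lower_local_dim \<mu> x \<longrightarrow> ereal r < sensitivity_at f T \<epsilon> x \<longrightarrow>
      ereal \<kappa> \<le> orbit_complexity_cover U enc f T \<beta> x"
proof -
  define E where "E k p = {x \<in> ball_decay_set \<mu> d (1 / real (Suc k)).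
      \<exists>\<omega> n. locates U enc f T \<beta> \<eta> r \<kappa> p x \<omega> n \<and> 2 powr (- r * f n) \<le> 1 / real (Suc k)}" for k p
  have "AE x in \<mu>. finite {p. x \<in> E k p}" for k
  proof (rule AE_in_finitely_many)
    show "\<exists>M\<in>sets \<mu>. E k p \<subseteq> M \<and>
        emeasure \<mu> M \<le> ennreal (real (length \<beta>) * 2 powr (- (d * r / \<kappa>) * real (length p)))" for p
      unfolding E_def by (rule located_points_small) fact+
    show "d * r / \<kappa> > 1"
      using pos less by simp
  qed simp
  then have "AE x in \<mu>. \<forall>k. finite {p. x \<in> E k p}"
    by (simp add: AE_all_countable)
  then show ?thesis
  proof eventually_elim
    case (elim x)
    show ?case
    proof (intro allI impI, rule ccontr)
      fix \<epsilon>
      assume \<epsilon>: "\<eta> \<le> \<epsilon>" and dim: "ereal d < lower_local_dim \<mu> x"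
        and sens: "ereal r < sensitivity_at f T \<epsilon> x"
        and "\<not> ereal \<kappa> \<le> orbit_complexity_cover U enc f T \<beta> x"
      then have compl: "orbit_complexity_cover U enc f T \<beta> x < ereal \<kappa>"
        by simp
      obtain k where k: "x \<in> ball_decay_set \<mu> d (1 / real (Suc k))"
        using lower_local_dim_gt_imp_ball_decay[OF dim] by blast
      have ev: "\<forall>\<^sub>F n in sequentially. 2 powr (- r * f n) \<le> 1 / real (Suc k)"
      proof -
        have "\<forall>\<^sub>F n in sequentially. f n \<ge> log 2 (real (Suc k)) / r"
          using f by (simp add: filterlim_at_top)
        then show ?thesis
        proof eventually_elim
          case (elim n)
          then have "- r * f n \<le> - log 2 (real (Suc k))"
            using pos by (simp add: field_simps)
          then have "2 powr (- r * f n) \<le> 2 powr (- log 2 (real (Suc k)))"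
            by (subst powr_le_cancel_iff) auto
          also have "\<dots> = 1 / real (Suc k)"
            by (simp add: powr_minus inverse_eq_divide)
          finally show ?case .
        qed
      qed
      define S where "S = {n. \<exists>p. x \<in> E k p \<and> (\<exists>\<omega>. locates U enc f T \<beta> \<eta> r \<kappa> p x \<omega> n)}"
      have "\<exists>\<^sub>F n in sequentially. orbit_ball T n x \<eta> \<subseteq> ball x (2 powr (- r * f n))"
        by (rule frequently_orbit_ball_small[OF bdd f sens \<epsilon>])
      then have "\<exists>\<^sub>F n in sequentially. orbit_ball T n x \<eta> \<subseteq> ball x (2 powr (- r * f n)) \<and>
         ((\<exists>\<omega>\<in>symbolic_orbits T \<beta> x. \<exists>p.
            U p = Some (enc (length \<beta>) (map \<omega> [0..<n])) \<and> real (length p) \<le> \<kappa> * f n) \<and>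
          2 powr (- r * f n) \<le> 1 / real (Suc k))"
        by (rule frequently_eventually_frequently)
          (intro eventually_conj ev eventually_short_program[OF enum univ f compl])
      then have "\<exists>\<^sub>F n in sequentially. n \<in> S"
      proof (rule frequently_elim1)
        fix n
        assume n: "orbit_ball T n x \<eta> \<subseteq> ball x (2 powr (- r * f n)) \<and>
         ((\<exists>\<omega>\<in>symbolic_orbits T \<beta> x. \<exists>p.
            U p = Some (enc (length \<beta>) (map \<omega> [0..<n])) \<and> real (length p) \<le> \<kappa> * f n) \<and>
          2 powr (- r * f n) \<le> 1 / real (Suc k))"
        then obtain \<omega> p where "locates U enc f T \<beta> \<eta> r \<kappa> p x \<omega> n"
          unfolding locates_def by blast
        then show "n \<in> S"
          unfolding S_def E_def using n k by blast
      qed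
      then have "infinite S"
        by (simp only: cofinite_eq_sequentially[symmetric] frequently_cofinite Collect_mem_eq not_False_eq_True)
      have "\<forall>n\<in>S. \<exists>p. x \<in> E k p \<and> (\<exists>\<omega>. locates U enc f T \<beta> \<eta> r \<kappa> p x \<omega> n)"
        unfolding S_def by blast
      then obtain P where P:
          "\<And>n. n \<in> S \<Longrightarrow> x \<in> E k (P n) \<and> (\<exists>\<omega>. locates U enc f T \<beta> \<eta> r \<kappa> (P n) x \<omega> n)"
        by metis
      have "inj_on P S"
        using P locates_same_word(1)[where enc = enc and \<beta> = \<beta>, OF inj] by (intro inj_onI) metis
      moreover have "P ` S \<subseteq> {p. x \<in> E k p}"
        using P by blast
      ultimately have "finite S"
        using elim inj_on_finite by blast
      with \<open>infinite S\<close> show False ..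
    qed
  qed
qed

section \<open>From countably many parameters to the inequality\<close>

lemma compact_cover_of_small_mesh:
  assumes "compact (UNIV :: 'a::metric_space set)" "\<eta> > 0"
  shows "\<exists>\<beta> :: 'a set list. finite_open_cover \<beta> \<and>
      (\<forall>B\<in>set \<beta>. \<forall>y\<in>B. \<forall>z\<in>B. dist y z \<le> \<eta>)"
proof -
  obtain C :: "'a set" where C: "finite C" "UNIV \<subseteq> (\<Union>x\<in>C. ball x (\<eta> / 2))"
  proof (rule compactE_image[OF assms(1), of UNIV "\<lambda>x. ball x (\<eta> / 2)"])
    show "UNIV \<subseteq> (\<Union>x::'a. ball x (\<eta> / 2))"
      using assms(2) by (auto intro!: exI)
  qed auto
  obtain xs where xs: "set xs = C"
    using finite_list[OF C(1)] by blast
  have "dist y z \<le> \<eta>" if "y \<in> ball x (\<eta> / 2)" "z \<in> ball x (\<eta> / 2)" for x y z :: 'a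
    using that dist_triangle3[of y z x] by simp
  moreover have "finite_open_cover (map (\<lambda>x. ball x (\<eta> / 2)) xs)"
    using C(2) xs by (auto simp: finite_open_cover_def)
  ultimately show ?thesis
    using xs by (intro exI[of _ "map (\<lambda>x. ball x (\<eta> / 2)) xs"]) auto
qed

lemma orbit_complexity_nonneg:
  assumes "filterlim f at_top sequentially"
  shows "0 \<le> orbit_complexity U enc f T x"
proof -
  have "\<forall>\<^sub>F n in sequentially. f n > 0"
    using assms by (simp add: filterlim_at_top_dense)
  then have "limsup (\<lambda>n. 0) \<le> orbit_complexity_cover U enc f T [UNIV] x"
    unfolding orbit_complexity_cover_def
  proof (intro Limsup_mono, elim eventually_mono)
    fix n assume "f n > 0"
    then show "0 \<le> (INF \<omega>\<in>symbolic_orbits T [UNIV] x.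
       ereal (real (AIC U (enc (length [UNIV]) (map \<omega> [0..<n])))) / ereal (f n))"
      by (intro INF_greatest) simp
  qed
  also have "\<dots> \<le> orbit_complexity U enc f T x"
    unfolding orbit_complexity_def
    by (rule SUP_upper) (simp add: finite_open_cover_def)
  finally show ?thesis
    by (simp add: Limsup_const)
qed

lemma rationals_below_product:
  fixes K a b :: ereal
  assumes "0 < a" "0 < b" "K < a * b"
  shows "\<exists>d r \<kappa> :: rat. 0 < d \<and> 0 < r \<and> 0 < \<kappa> \<and> \<kappa> < d * r \<and>
      ereal (real_of_rat d) < a \<and> ereal (real_of_rat r) < b \<and> K < ereal (real_of_rat \<kappa>)"
proof -
  have "max 0 K < a * b"
    using assms by (simp add: ereal_zero_less_0_iff)
  then obtain \<kappa> :: rat where \<kappa>: "max 0 K < real_of_rat \<kappa>" "real_of_rat \<kappa> < a * b"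
    using ereal_dense3 by blast
  then have "0 < \<kappa>"
    by simp
  \<comment> \<open>A factor \<open>d\<close> leaves room for some \<open>r < b\<close> with \<open>\<kappa> < d r\<close> as soon as it exceeds \<open>\<kappa> / b\<close>.\<close>
  define l where "l = (if b = \<infinity> then 0 else ereal (real_of_rat \<kappa>) / b)"
  have "l < a"
    using assms \<kappa>(2) by (auto simp: l_def ereal_divide_less_pos mult.commute)
  moreover have "0 \<le> l"
    using assms(2) \<open>0 < \<kappa>\<close> by (cases b) (auto simp: l_def)
  ultimately obtain d :: rat where d: "l < real_of_rat d" "real_of_rat d < a"
    using ereal_dense3 by blast
  have "0 < d"
    using d(1) \<open>0 \<le> l\<close> by (metis ereal_less(2) order_le_less_trans zero_less_of_rat_iff)
  have "ereal (real_of_rat (\<kappa> / d)) < b"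
    using d(1) \<open>0 < d\<close> assms(2) by (cases b) (auto simp: l_def of_rat_divide field_simps)
  then obtain r :: rat where r: "ereal (real_of_rat (\<kappa> / d)) < real_of_rat r" "real_of_rat r < b"
    using ereal_dense3 by blast
  have "\<kappa> / d < r"
    using r(1) by (simp add: of_rat_less)
  moreover have "0 < \<kappa> / d"
    using \<open>0 < \<kappa>\<close> \<open>0 < d\<close> by simp
  ultimately have "0 < r" "\<kappa> < d * r"
    using \<open>0 < d\<close> by (auto intro: less_trans simp: pos_divide_less_eq mult.commute)
  then show ?thesis
    using \<kappa> d r \<open>0 < \<kappa>\<close> \<open>0 < d\<close> by auto
qed

theorem theorem42:
  fixes \<I> :: "(str \<Rightarrow> 'a::metric_space) set"
    and T :: "'a \<Rightarrow> 'a"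
    and f :: "nat \<Rightarrow> real"
    and \<mu> :: "'a measure"
    and A :: "nat \<Rightarrow> str \<Rightarrow> str option"
    and U :: "str \<Rightarrow> str option"
    and enc :: "nat \<Rightarrow> nat list \<Rightarrow> str"
  assumes "recursive_enumeration A"
    and "universal_machine A U"
    and "computable_word_encoding enc"
    and "compact (UNIV :: 'a set)"
    and "computable_structure \<I>"
    and "constructive \<I> T"
    and "mono f"
    and "filterlim f at_top sequentially"
    and "sets \<mu> = sets borel"
  shows "AE x in \<mu>.
    \<not> indeterminate_product (lower_local_dim \<mu> x) (sensitivity f T x) \<longrightarrow>
    lower_local_dim \<mu> x * sensitivity f T x \<le> orbit_complexity U enc f T x"
proof -
  have bdd: "bounded (UNIV :: 'a set)"
    by (rule compact_imp_bounded) fact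
  have "\<forall>m. \<exists>\<beta> :: 'a set list. finite_open_cover \<beta> \<and>
      (\<forall>B\<in>set \<beta>. \<forall>y\<in>B. \<forall>z\<in>B. dist y z \<le> 1 / real (Suc m))"
    by (intro allI compact_cover_of_small_mesh[OF assms(4)]) simp
  then obtain \<beta> :: "nat \<Rightarrow> 'a set list" where cover: "\<And>m. finite_open_cover (\<beta> m)"
    and mesh: "\<And>m B y z. B \<in> set (\<beta> m) \<Longrightarrow> y \<in> B \<Longrightarrow> z \<in> B \<Longrightarrow> dist y z \<le> 1 / real (Suc m)"
    by metis
  have inj: "inj_on (enc (length (\<beta> m))) {w. set w \<subseteq> {..<length (\<beta> m)}}" for m
  proof -
    have "\<beta> m \<noteq> []"
      using cover[of m] by (auto simp: finite_open_cover_def)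
    then have "length (\<beta> m) \<ge> 1"
      by (simp add: Suc_le_eq)
    then show ?thesis
      using assms(3) bij_betw_imp_inj_on unfolding computable_word_encoding_def by blast
  qed
  have "AE x in \<mu>. \<forall>m (d::rat) (r::rat) (\<kappa>::rat).
      0 < d \<and> 0 < r \<and> 0 < \<kappa> \<and> \<kappa> < d * r \<longrightarrow>
      (\<forall>\<epsilon>\<ge>1 / real (Suc m). ereal (real_of_rat d) < lower_local_dim \<mu> x \<longrightarrow>
        ereal (real_of_rat r) < sensitivity_at f T \<epsilon> x \<longrightarrow>
        ereal (real_of_rat \<kappa>) \<le> orbit_complexity_cover U enc f T (\<beta> m) x)"
    unfolding AE_all_countable
  proof (intro allI)
    fix m and d r \<kappa> :: rat
    show "AE x in \<mu>. 0 < d \<and> 0 < r \<and> 0 < \<kappa> \<and> \<kappa> < d * r \<longrightarrow>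
      (\<forall>\<epsilon>\<ge>1 / real (Suc m). ereal (real_of_rat d) < lower_local_dim \<mu> x \<longrightarrow>
        ereal (real_of_rat r) < sensitivity_at f T \<epsilon> x \<longrightarrow>
        ereal (real_of_rat \<kappa>) \<le> orbit_complexity_cover U enc f T (\<beta> m) x)"
    proof (cases "0 < d \<and> 0 < r \<and> 0 < \<kappa> \<and> \<kappa> < d * r")
      case True
      then have "real_of_rat \<kappa> < real_of_rat d * real_of_rat r"
        by (simp add: of_rat_less of_rat_mult[symmetric])
      then show ?thesis
        using AE_not_compressible[where enc = enc and \<beta> = "\<beta> m", OF assms(1,2) bdd assms(8,9) mesh inj] True by simp
    qed auto
  qed
  then show ?thesis
  proof eventually_elim
    case (elim x)
    show ?case
    proof (intro impI, rule ccontr)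
      assume "\<not> lower_local_dim \<mu> x * sensitivity f T x \<le> orbit_complexity U enc f T x"
      then have less: "orbit_complexity U enc f T x < lower_local_dim \<mu> x * sensitivity f T x"
        by simp
      \<comment> \<open>As the sensitivity is never negative, a positive product has two positive factors. This
        excludes the points of dimension \<open>-\<infinity>\<close>, all of whose balls have infinite measure.\<close>
      then have "0 < lower_local_dim \<mu> x * sensitivity f T x"
        using orbit_complexity_nonneg[OF assms(8)] order_le_less_trans by blast
      then have "0 < lower_local_dim \<mu> x" "0 < sensitivity f T x"
        using sensitivity_nonneg[OF bdd assms(8), of T x]
        by (auto simp: ereal_zero_less_0_iff)
      then obtain d r \<kappa> :: rat where par: "0 < d \<and> 0 < r \<and> 0 < \<kappa> \<and> \<kappa> < d * r"
        and d: "ereal (real_of_rat d) < lower_local_dim \<mu> x"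
        and r: "ereal (real_of_rat r) < sensitivity f T x"
        and \<kappa>: "orbit_complexity U enc f T x < ereal (real_of_rat \<kappa>)"
        using rationals_below_product[OF _ _ less] by blast
      obtain \<epsilon> where "\<epsilon> > 0" and \<epsilon>: "ereal (real_of_rat r) < sensitivity_at f T \<epsilon> x"
        using r by (auto simp: sensitivity_def less_SUP_iff)
      obtain m where "1 / real (Suc m) < \<epsilon>"
        using nat_approx_posE[OF \<open>\<epsilon> > 0\<close>] by blast
      then have "ereal (real_of_rat \<kappa>) \<le> orbit_complexity_cover U enc f T (\<beta> m) x"
        using elim par d \<epsilon> less_imp_le by blast
      also have "\<dots> \<le> orbit_complexity U enc f T x"
        unfolding orbit_complexity_def using cover by (intro SUP_upper) simp
      finally show False
        using \<kappa> by simp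
    qed
  qed
qed

end
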